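(* Let $S \subseteq \mathbb{Z}$ with $|S| = 4$. Then $p_{\mathbb{Z}}(S) \ge 3$; that is, there is a coloring of $\mathbb{Z}$ with $3$ colors such that every translate $n+S$, $n \in \mathbb{Z}$, contains an element of each of the three colors.
   Context: For an abelian group $G$, $S \subseteq G$ and $n \in G$, the set $n+S=\{n+s : s\in S\}$ is a translate of $S$. A coloring of the elements of $G$ is $S$-polychromatic if every translate of $S$ contains an element of each color. The polychromatic number $p_G(S)$ (written $p(S)$ when $G$ is clear) is the largest number of colors for which an $S$-polychromatic coloring of $G$ exists. *)

theory Defs
  imports Main
begin

definition translate :: "'a::ab_group_add \<Rightarrow> 'a set \<Rightarrow> 'a set" where
  "translate n S = (\<lambda>s. n + s) ` S"

definition polychromatic :: "nat \<Rightarrow> 'a set \<Rightarrow> ('a::ab_group_add \<Rightarrow> nat) \<Rightarrow> bool" where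
  "polychromatic k S c \<longleftrightarrow> (\<forall>x. c x < k) \<and>
     (\<forall>n. \<forall>i<k. \<exists>y\<in>translate n S. c y = i)"

definition poly_number :: "'a::ab_group_add set \<Rightarrow> nat" where
  "poly_number S = (GREATEST k. \<exists>c. polychromatic k S c)"

end

theory Submission
  imports Defs "HOL-Analysis.Kronecker_Approximation_Theorem" "HOL-Number_Theory.Cong"
begin

text \<open>
  Up to translation and scaling let \<open>S = {0, a, b, c}\<close> with \<open>0 < a < b < c\<close> coprime. Modulo
  \<open>m = b + c - a\<close> the set becomes the parallelogram \<open>{0, b, c, b + c}\<close>. Winding the cyclic group of
  order \<open>m\<close> around a circle by \<open>n \<mapsto> j * n / m\<close> and colouring the circle by three arcs of equal length
  works as soon as the four image points leave no gap longer than a third of the circle. In terms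
  of \<open>(j * b / m, j * c / m)\<close> this asks for a lattice point in a union of four triangles of the torus.
  By Dirichlet's theorem the lattice contains a vector \<open>(e, f) / m\<close> of size about \<open>1 / sqrt m\<close>. If its
  direction is neither an axis nor a diagonal, its multiples enter a triangle; otherwise the lattice
  is a union of parallel lines and one of these meets a triangle in a long segment. This settles all
  \<open>m \<ge> 37\<close>, up to finitely many \<open>(m, e, f)\<close> that are checked by computation, unless a diagonal of the
  parallelogram has order two modulo \<open>m\<close>; that family has an explicit colouring modulo \<open>m\<close>. For
  \<open>m \<le> 36\<close> a list of circle windings suffices, apart from \<open>{0, 1, 7, 9}\<close>.
\<close>

section \<open>Colourings from windings of the circle\<close>

definition colorable3 :: "int set \<Rightarrow> bool" where
  "colorable3 S \<longleftrightarrow> (\<exists>c. polychromatic 3 S c)"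

lemma colorable3I:
  fixes c :: "int \<Rightarrow> nat"
  assumes "\<And>n. c n < 3"
    and "\<And>n i. i < 3 \<Longrightarrow> \<exists>s\<in>S. c (n + s) = i"
  shows "colorable3 S"
  unfolding colorable3_def polychromatic_def translate_def using assms by blast

lemma colorable3E:
  assumes "colorable3 S"
  obtains c :: "int \<Rightarrow> nat" where "\<And>n. c n < 3"
    and "\<And>n i. i < 3 \<Longrightarrow> \<exists>s\<in>S. c (n + s) = i"
  using assms unfolding colorable3_def polychromatic_def translate_def by blast

section \<open>Invariance under translation, reflection and scaling\<close>

lemma colorable3_translate:
  assumes "colorable3 S"
  shows "colorable3 ((+) d ` S)"
proof -
  obtain c :: "int \<Rightarrow> nat" where c: "\<And>n. c n < 3" "\<And>n i. i < 3 \<Longrightarrow> \<exists>s\<in>S. c (n + s) = i"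
    by (rule colorable3E[OF assms]) blast
  show ?thesis
  proof (rule colorable3I[of c])
    fix n :: int and i :: nat assume "i < 3"
    then obtain s where "s \<in> S" "c (n + d + s) = i" using c(2) by blast
    then show "\<exists>s\<in>(+) d ` S. c (n + s) = i" by (auto simp: add.assoc)
  qed (rule c(1))
qed

lemma colorable3_reflect:
  assumes "colorable3 S"
  shows "colorable3 (uminus ` S)"
proof -
  obtain c :: "int \<Rightarrow> nat" where c: "\<And>n. c n < 3" "\<And>n i. i < 3 \<Longrightarrow> \<exists>s\<in>S. c (n + s) = i"
    by (rule colorable3E[OF assms]) blast
  show ?thesis
  proof (rule colorable3I[of "\<lambda>n. c (- n)"])
    fix n :: int and i :: nat assume "i < 3"
    then obtain s where "s \<in> S" "c (- n + s) = i" using c(2) by blast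
    then show "\<exists>s\<in>uminus ` S. c (- (n + s)) = i" by auto
  qed (rule c(1))
qed

lemma colorable3_scale:
  assumes "colorable3 S" "0 < d"
  shows "colorable3 ((*) d ` S)"
proof -
  obtain c :: "int \<Rightarrow> nat" where c: "\<And>n. c n < 3" "\<And>n i. i < 3 \<Longrightarrow> \<exists>s\<in>S. c (n + s) = i"
    by (rule colorable3E[OF assms(1)]) blast
  show ?thesis
  \<comment> \<open>Each residue class modulo \<open>d\<close> carries its own copy of
    \<open>c\<close>, since \<open>(n + d * s) div d = n div d + s\<close>.\<close>
  proof (rule colorable3I[of "\<lambda>n. c (n div d)"])
    fix n :: int and i :: nat assume "i < 3"
    then obtain s where "s \<in> S" "c (n div d + s) = i" using c(2) by blast
    then show "\<exists>s\<in>(*) d ` S. c ((n + s) div d) = i" using assms(2)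
      by (auto simp: add.commute intro!: bexI[of _ s])
  qed (rule c(1))
qed

text \<open>Wind the integers around a circle of length \<open>N\<close> by multiplication with \<open>t\<close> and cut the
  circle into three half-open arcs of length \<open>N/3\<close>. If from every point of \<open>S\<close> another one is
  reached within \<open>N/3\<close>, then no rotated copy of \<open>S\<close> can avoid an arc.\<close>

lemma colorable3_arcs:
  fixes N t :: int
  assumes "finite S" "S \<noteq> {}" "0 < N"
    and step: "\<And>s. s \<in> S \<Longrightarrow>
      \<exists>s'\<in>S. 0 < (t * (s' - s)) mod N \<and> 3 * ((t * (s' - s)) mod N) \<le> N"
  shows "colorable3 S"
proof (rule colorable3I[of "\<lambda>n. nat (3 * ((t * n) mod N) div N)"])
  fix n :: int
  define x where "x = 3 * ((t * n) mod N)"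
  have "x div N < 3"
  proof (rule ccontr)
    assume "\<not> ?thesis"
    then have "3 * N \<le> x div N * N" using \<open>0 < N\<close> by (intro mult_right_mono) auto
    also have "\<dots> \<le> x" using \<open>0 < N\<close> by (simp flip: minus_mod_eq_div_mult)
    also have "x < 3 * N" using \<open>0 < N\<close> by (simp add: x_def)
    finally show False by simp
  qed
  then show "nat (3 * ((t * n) mod N) div N) < 3" by (simp add: x_def)
next
  fix n :: int and i :: nat assume i: "i < 3"
  \<comment> \<open>\<open>w\<close> is \<open>i * N / 3\<close> rounded up, the first integer in
    arc \<open>i\<close>; \<open>R s\<close> measures the position of \<open>t * (n + s)\<close>
    from there.\<close>
  define w where "w = - ((- (int i * N)) div 3)"
  define R where "R s = (t * (n + s) - w) mod N" for s
  have "z \<le> 3 * - ((- z) div 3) \<and> 3 * - ((- z) div 3) \<le> z + 2" for z :: int by presburger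
  then have w: "int i * N \<le> 3 * w" "3 * w \<le> int i * N + 2" unfolding w_def by blast+
  \<comment> \<open>The point farthest along from \<open>w\<close> is followed, within
    \<open>N / 3\<close>, by a point that has passed \<open>w\<close> again and so falls into the
    arc.\<close>
  have "Max (R ` S) \<in> R ` S" using assms(1,2) by (intro Max_in) auto
  then obtain s where "s \<in> S" "R s = Max (R ` S)" by auto
  then have s: "s \<in> S" "\<And>s'. s' \<in> S \<Longrightarrow> R s' \<le> R s" using assms(1) by auto
  define d where "d s' = (t * (s' - s)) mod N" for s'
  obtain s' where s': "s' \<in> S" "0 < d s'" "3 * d s' \<le> N"
    using step[OF s(1)] unfolding d_def by blast
  have Rs: "0 \<le> R s" "R s < N" using \<open>0 < N\<close> by (simp_all add: R_def)
  have R': "R s' = (R s + d s') mod N"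
    unfolding R_def d_def by (simp add: mod_add_eq algebra_simps)
  have "R s + d s' \<ge> N"
  proof (rule ccontr)
    assume "\<not> ?thesis"
    then have "R s' = R s + d s'" using R' Rs s'(2) by simp
    then show False using s(2)[OF s'(1)] s'(2) by simp
  qed
  moreover have "R s + d s' - N < N" using Rs s'(2,3) \<open>0 < N\<close> by linarith
  ultimately have R'': "R s' = R s + d s' - N"
    using R' by (metis diff_ge_0_iff_ge minus_mod_self2 mod_pos_pos_trivial)
  have iN: "int i * N \<le> 2 * N" using i \<open>0 < N\<close> by (intro mult_right_mono) auto
  have i0: "0 \<le> int i * N" using \<open>0 < N\<close> by simp
  have "0 \<le> w" using w(1) i0 by linarith
  have R0: "0 \<le> R s'" using \<open>0 < N\<close> by (simp add: R_def)
  \<comment> \<open>Rounding adds at most 2 to \<open>3 * w\<close>, while \<open>R s < N\<close>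
    saves 3, so the excluded end of the arc is not reached.\<close>
  have up: "3 * (w + R s') < int i * N + N" using w(2) R'' Rs s'(3) by (smt (verit))
  have "w + R s' < N" using up iN by (smt (verit))
  moreover have "(w + R s') mod N = (t * (n + s')) mod N"
    unfolding R_def by (simp add: mod_add_right_eq)
  ultimately have v: "(t * (n + s')) mod N = w + R s'"
    using \<open>0 \<le> w\<close> R0 by simp
  have "3 * (w + R s') div N = int i"
    using up w(1) R0 \<open>0 < N\<close>
    by (intro int_div_pos_eq[of _ _ _ "3 * (w + R s') - int i * N"]) (auto simp: mult.commute)
  then show "\<exists>s\<in>S. nat (3 * ((t * (n + s)) mod N) div N) = i"
    using s'(1) v by (intro bexI[of _ s']) auto
qed

text \<open>On the circle of length \<open>m\<close> the points \<open>0\<close>, \<open>u\<close>, \<open>v\<close>, \<open>u + v\<close> leave no gap longer than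
  \<open>m / 3\<close>. Relative to the centre \<open>(m / 2, m / 2)\<close> of the torus the admissible \<open>(u, v)\<close> form the
  diamond of radius \<open>m / 3\<close> without the inscribed square of half-width \<open>m / 6\<close>, that is, four
  triangles.\<close>

definition hit :: "int \<Rightarrow> int \<Rightarrow> int \<Rightarrow> bool" where
  "hit m u v \<longleftrightarrow> (\<exists>p q. m \<le> 3 * max \<bar>2 * u - (2 * p + 1) * m\<bar> \<bar>2 * v - (2 * q + 1) * m\<bar> \<and>
     3 * (\<bar>2 * u - (2 * p + 1) * m\<bar> + \<bar>2 * v - (2 * q + 1) * m\<bar>) \<le> 2 * m)"

lemma hit_swap: "hit m u v \<Longrightarrow> hit m v u"
  unfolding hit_def by (metis add.commute max.commute)

lemma hit_neg:
  assumes "hit m u v"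
  shows "hit m (- u) v"
proof -
  obtain p q where "m \<le> 3 * max \<bar>2 * u - (2 * p + 1) * m\<bar> \<bar>2 * v - (2 * q + 1) * m\<bar>"
     "3 * (\<bar>2 * u - (2 * p + 1) * m\<bar> + \<bar>2 * v - (2 * q + 1) * m\<bar>) \<le> 2 * m"
    using assms unfolding hit_def by blast
  moreover have "\<bar>2 * (- u) - (2 * (- p - 1) + 1) * m\<bar> = \<bar>2 * u - (2 * p + 1) * m\<bar>"
  proof -
    have "2 * (- u) - (2 * (- p - 1) + 1) * m = - (2 * u - (2 * p + 1) * m)"
      by (simp add: algebra_simps)
    then show ?thesis by (simp only: abs_minus_cancel)
  qed
  ultimately show ?thesis
    unfolding hit_def by - (rule exI[of _ "- p - 1"], rule exI[of _ q], simp only: simp_thms)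
qed

lemma hit_cong:
  assumes "hit m u v" "[u = u'] (mod m)" "[v = v'] (mod m)"
  shows "hit m u' v'"
proof -
  obtain p q where h: "m \<le> 3 * max \<bar>2 * u - (2 * p + 1) * m\<bar> \<bar>2 * v - (2 * q + 1) * m\<bar>"
     "3 * (\<bar>2 * u - (2 * p + 1) * m\<bar> + \<bar>2 * v - (2 * q + 1) * m\<bar>) \<le> 2 * m"
    using assms unfolding hit_def by blast
  obtain k l where kl: "u' = u + m * k" "v' = v + m * l"
    using assms(2,3) by (auto simp: cong_iff_lin)
  have "2 * u' - (2 * (p + k) + 1) * m = 2 * u - (2 * p + 1) * m"
       "2 * v' - (2 * (q + l) + 1) * m = 2 * v - (2 * q + 1) * m"
    by (simp_all add: kl algebra_simps)
  then show ?thesis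
    unfolding hit_def using h by - (rule exI[of _ "p + k"], rule exI[of _ "q + l"], simp only: simp_thms)
qed

text \<open>In units of \<open>m\<close> and up to the integer shift \<open>(p, q)\<close>, this is
  the lower triangle, with corners (1/3, 1/3), (2/3, 1/3), (1/2, 1/6). \<open>hitI2\<close>
  describes the left triangle, and \<open>hitI3\<close> the right one moved one period to the
  left.\<close>

lemma hitI1:
  assumes "3 * (v - q * m) \<le> m" "3 * ((u - p * m) - (v - q * m)) \<le> m"
    "2 * m \<le> 3 * ((u - p * m) + (v - q * m))"
  shows "hit m u v"
  unfolding hit_def
proof (rule exI[of _ p], rule exI[of _ q])
  define x y where "x = u - p * m" and "y = v - q * m"
  have *: "2 * u - (2 * p + 1) * m = 2 * x - m" "2 * v - (2 * q + 1) * m = 2 * y - m"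
    unfolding x_def y_def by (simp_all add: algebra_simps)
  show "m \<le> 3 * max \<bar>2 * u - (2 * p + 1) * m\<bar> \<bar>2 * v - (2 * q + 1) * m\<bar> \<and>
     3 * (\<bar>2 * u - (2 * p + 1) * m\<bar> + \<bar>2 * v - (2 * q + 1) * m\<bar>) \<le> 2 * m"
    unfolding * using assms[folded x_def y_def] by (auto simp: max_def abs_if split: if_splits)
qed

lemma hitI2:
  assumes "3 * (u - p * m) \<le> m" "3 * ((v - q * m) - (u - p * m)) \<le> m"
    "2 * m \<le> 3 * ((u - p * m) + (v - q * m))"
  shows "hit m u v"
  using hit_swap[OF hitI1[of u p m v q]] assms by (simp add: algebra_simps)

lemma hitI3:
  assumes "- m \<le> 3 * (u - p * m)" "3 * ((u - p * m) + (v - q * m)) \<le> m"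
    "2 * m \<le> 3 * ((v - q * m) - (u - p * m))"
  shows "hit m u v"
proof -
  have "hit m (- u) v"
    using assms by (intro hitI2[of "- u" "- p" m v q]) (simp_all add: algebra_simps)
  from hit_neg[OF this] show ?thesis by simp
qed

lemma mod_stepI:
  fixes m :: int
  assumes "y = x + d + k * m" "0 < d" "3 * d \<le> m"
  shows "0 < (y - x) mod m \<and> 3 * ((y - x) mod m) \<le> m"
proof -
  have "(y - x) mod m = d" using assms by simp
  then show ?thesis using assms by simp
qed

text \<open>Let \<open>v\<close> be the coordinate farther from the centre. If its residue
  \<open>y\<close> is in the lower half, the circular order is 0, \<open>y\<close>,
  \<open>x\<close>, \<open>x + y\<close>, and the triangle inequalities bound all gaps by
  \<open>m / 3\<close>. In the upper half, \<open>w = m - y\<close> plays the same part.\<close>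

lemma hit_step:
  assumes "0 < m" "hit m u v" and z: "z \<in> {0, u, v, u + v}"
  shows "\<exists>y\<in>{0, u, v, u + v}. 0 < (y - z) mod m \<and> 3 * ((y - z) mod m) \<le> m"
proof -
  have main: "\<exists>y\<in>{0, u, v, u + v}. 0 < (y - z) mod m \<and> 3 * ((y - z) mod m) \<le> m"
    if h: "m \<le> 3 * \<bar>2 * v - (2 * q + 1) * m\<bar>"
      "3 * (\<bar>2 * u - (2 * p + 1) * m\<bar> + \<bar>2 * v - (2 * q + 1) * m\<bar>) \<le> 2 * m"
      and z: "z \<in> {0, u, v, u + v}" for p q u v
  proof -
    define x y where "x = u - p * m" and "y = v - q * m"
    have *: "2 * u - (2 * p + 1) * m = 2 * x - m" "2 * v - (2 * q + 1) * m = 2 * y - m"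
      unfolding x_def y_def by (simp_all add: algebra_simps)
    have u: "u = x + p * m" and v: "v = y + q * m" by (simp_all add: x_def y_def)
    have st: ?thesis if "y' \<in> {0, u, v, u + v}" "y' = z + d + k * m" "0 < d" "3 * d \<le> m" for y' d k
      using mod_stepI[OF that(2-4)] that(1) by blast
    show ?thesis
    proof (cases "2 * y \<le> m")
      case True
      then have b: "3 * y \<le> m" "3 * (x - y) \<le> m" "2 * m \<le> 3 * (x + y)" "y \<le> x" "0 < y"
        using h[unfolded *] \<open>0 < m\<close> by (auto simp: abs_if split: if_splits)
      have 1: ?thesis if "z = 0"
        by (rule st[of v y q]) (use b that in \<open>simp_all add: u v algebra_simps\<close>)
      have 2: ?thesis if "z = u"
        by (rule st[of "u + v" y q]) (use b that in \<open>simp_all add: u v algebra_simps\<close>)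
      have 3: ?thesis if "z = u + v" "x + y < m"
        by (rule st[of 0 "m - x - y" "- 1 - p - q"]) (use b that in \<open>simp_all add: u v algebra_simps\<close>)
      \<comment> \<open>Two points coincide on the circle here; the next one after both is
        taken.\<close>
      have 4: ?thesis if "z = u + v" "x + y = m"
        by (rule st[of v "y" "- 1 - p"]) (use b that in \<open>simp_all add: u v algebra_simps\<close>)
      have 5: ?thesis if "z = v" "y < x"
        by (rule st[of u "x - y" "p - q"]) (use b that in \<open>simp_all add: u v algebra_simps\<close>)
      have 6: ?thesis if "z = v" "y = x"
        by (rule st[of "u + v" "y" "p"]) (use b that in \<open>simp_all add: u v algebra_simps\<close>)
      have "x + y \<le> m" using b(1,2) by presburger
      then show ?thesis using z 1 2 3 4 5 6 b(4) by (elim insertE emptyE) (metis order_le_less)+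
    next
      case False
      define w where "w = m - y"
      have b: "3 * w \<le> m" "3 * (x - w) \<le> m" "2 * m \<le> 3 * (x + w)" "w \<le> x" "0 < w"
        using False h[unfolded *] \<open>0 < m\<close> by (auto simp: w_def abs_if split: if_splits)
      have v: "v = (q + 1) * m - w" by (simp add: v w_def algebra_simps)
      have 1: ?thesis if "z = v"
        by (rule st[of 0 w "- q - 1"]) (use b that in \<open>simp_all add: u v algebra_simps\<close>)
      have 2: ?thesis if "z = u + v"
        by (rule st[of u w "- q - 1"]) (use b that in \<open>simp_all add: u v algebra_simps\<close>)
      have 3: ?thesis if "z = u" "x + w < m"
        by (rule st[of v "m - x - w" "q - p"]) (use b that in \<open>simp_all add: u v algebra_simps\<close>)
      have 4: ?thesis if "z = u" "x + w = m"
        by (rule st[of 0 "w" "- 1 - p"]) (use b that in \<open>simp_all add: u v algebra_simps\<close>)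
      have 5: ?thesis if "z = 0" "w < x"
        by (rule st[of "u + v" "x - w" "p + q + 1"]) (use b that in \<open>simp_all add: u v algebra_simps\<close>)
      have 6: ?thesis if "z = 0" "w = x"
        by (rule st[of u w "p"]) (use b that in \<open>simp_all add: u v algebra_simps\<close>)
      have "x + w \<le> m" using b(1,2) by presburger
      then show ?thesis using z 1 2 3 4 5 6 b(4) by (elim insertE emptyE) (metis order_le_less)+
    qed
  qed
  obtain p q where h: "m \<le> 3 * max \<bar>2 * u - (2 * p + 1) * m\<bar> \<bar>2 * v - (2 * q + 1) * m\<bar>"
     "3 * (\<bar>2 * u - (2 * p + 1) * m\<bar> + \<bar>2 * v - (2 * q + 1) * m\<bar>) \<le> 2 * m"
    using assms(2) unfolding hit_def by blast
  show ?thesis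
  proof (cases "\<bar>2 * u - (2 * p + 1) * m\<bar> \<le> \<bar>2 * v - (2 * q + 1) * m\<bar>")
    case True
    then show ?thesis using main[of v q u p] h z by (simp add: max_def)
  next
    case False
    have "z \<in> {0, v, u, v + u}" using z by auto
    then have "\<exists>y\<in>{0, v, u, v + u}. 0 < (y - z) mod m \<and> 3 * ((y - z) mod m) \<le> m"
      using main[of u p v q] h False by (simp add: max_def add.commute)
    then show ?thesis by (auto simp: add.commute)
  qed
qed

definition good :: "int \<Rightarrow> int \<Rightarrow> int \<Rightarrow> bool" where
  "good m x y \<longleftrightarrow> (\<exists>j. hit m (j * x) (j * y))"

lemma good_swap: "good m x y \<Longrightarrow> good m y x"
  unfolding good_def by (blast intro: hit_swap)

lemma good_neg: "good m (- x) y \<Longrightarrow> good m x y"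
  unfolding good_def using hit_neg[of m "j * - x" for j] by (metis minus_mult_right minus_minus)

lemma good_mult: 
  assumes "good m u v" "[j * x = u] (mod m)" "[j * y = v] (mod m)" 
  shows "good m x y"
proof -
  obtain i where "hit m (i * u) (i * v)" using assms(1) unfolding good_def by blast
  moreover have "[i * u = i * j * x] (mod m)" "[i * v = i * j * y] (mod m)"
    using cong_scalar_left[OF assms(2), of i] cong_scalar_left[OF assms(3), of i]
    by (simp_all add: cong_sym_eq mult.assoc)
  ultimately have "hit m (i * j * x) (i * j * y)" by (rule hit_cong)
  then show ?thesis unfolding good_def by blast
qed

lemma goodI:
  assumes "hit m u v" "[j * x = u] (mod m)" "[j * y = v] (mod m)" 
  shows "good m x y"
  using good_mult[of m u v j x y] assms by (metis good_def mult_1)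

text \<open>Modulo \<open>m\<close> the point \<open>a\<close> becomes the corner
  \<open>b + c\<close>, so winding by \<open>j\<close> produces the four points of
  \<open>hit_step\<close>.\<close>

lemma colorable3_parallelogram:
  assumes "0 < m" "good m b c" "a + m = b + c" "a \<notin> {0, b, c}"
  shows "colorable3 {0, a, b, c}"
proof -
  obtain j where j: "hit m (j * b) (j * c)" using assms(2) unfolding good_def by blast
  let ?T = "{0, j * b, j * c, j * b + j * c}"
  have a: "j * a = j * b + j * c + (- j) * m" using arg_cong[OF assms(3), of "(*) j"] by (simp add: algebra_simps)
  show ?thesis
  proof (rule colorable3_arcs[of _ m j])
    fix s assume s: "s \<in> {0, a, b, c}"
    define F where "F s = (if s = a then j * b + j * c else j * s)" for s
    have F: "(F y - F x) mod m = (j * (y - x)) mod m" for x y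
    proof -
      have "[F y = j * y] (mod m)" for y
        unfolding F_def using a by (auto simp: cong_iff_lin intro!: exI[of _ "- j"])
      then show ?thesis by (metis cong_diff cong_def right_diff_distrib)
    qed
    have F0: "F 0 = 0" "F b = j * b" "F c = j * c" using assms(4) by (auto simp: F_def)
    have img: "F ` {0, a, b, c} = ?T"
      using F0 by (auto simp: F_def)
    have "F s \<in> ?T" using s img by blast
    from hit_step[OF assms(1) j this] obtain y where
      "y \<in> F ` {0, a, b, c}" "0 < (y - F s) mod m" "3 * ((y - F s) mod m) \<le> m"
      unfolding img by blast
    then show "\<exists>s'\<in>{0, a, b, c}. 0 < (j * (s' - s)) mod m \<and> 3 * ((j * (s' - s)) mod m) \<le> m"
      using F by auto
  qed (use assms in auto)
qed

section \<open>Multiples of a short lattice vector\<close>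

lemma ceiling_multiple:
  fixes A B :: int
  assumes "0 < B"
  obtains l where "A \<le> l * B" "l * B < A + B"
proof
  have "(- A) div B * B = - A - (- A) mod B" by (simp add: minus_mod_eq_div_mult)
  then show "A \<le> - ((- A) div B) * B" "- ((- A) div B) * B < A + B"
    using assms pos_mod_bound[of B "- A"] pos_mod_sign[of B "- A"] by auto
qed

lemma mult_bound_above:
  fixes B :: int
  assumes "l * B \<le> X" "0 < B" "0 \<le> D" "X * D \<le> C * B"
  shows "l * D \<le> C"
proof -
  have "(l * B) * D \<le> X * D" using assms by (intro mult_right_mono) auto
  then have "(l * D) * B \<le> C * B" using assms(4) by (simp add: algebra_simps)
  then show ?thesis using assms(2) by simp
qed

lemma mult_bound_below:
  fixes B :: int
  assumes "X \<le> l * B" "0 < B" "0 \<le> D" "C * B \<le> X * D"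
  shows "C \<le> l * D"
proof -
  have "X * D \<le> (l * B) * D" using assms by (intro mult_right_mono) auto
  then have "C * B \<le> (l * D) * B" using assms(4) by (simp add: algebra_simps)
  then show ?thesis using assms(2) by simp
qed

text \<open>\<open>l\<close> is the first multiple past the edge \<open>x + y = 2/3\<close> of the
  lower triangle at \<open>(p, q)\<close>. The last two hypotheses say that even one full step
  beyond this edge the other two edge inequalities hold.\<close>

lemma good_triangle1:
  assumes "0 < f" "f < e"
    and "((2 + 3 * p + 3 * q) * m + 3 * (e + f)) * f \<le> (1 + 3 * q) * m * (e + f)"
    and "((2 + 3 * p + 3 * q) * m + 3 * (e + f)) * (e - f) \<le> (1 + 3 * (p - q)) * m * (e + f)"
  shows "good m e f"
proof -
  have B: "0 < 3 * (e + f)" using assms by simp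
  obtain l where l: "(2 + 3 * p + 3 * q) * m \<le> l * (3 * (e + f))"
      "l * (3 * (e + f)) < (2 + 3 * p + 3 * q) * m + 3 * (e + f)"
    using ceiling_multiple[OF B] by blast
  have 1: "l * (3 * f) \<le> (1 + 3 * q) * m"
    using mult_bound_above[OF less_imp_le[OF l(2)] B, of "3 * f" "(1 + 3 * q) * m"] assms
    by (simp add: algebra_simps)
  have 2: "l * (3 * (e - f)) \<le> (1 + 3 * (p - q)) * m"
    using mult_bound_above[OF less_imp_le[OF l(2)] B, of "3 * (e - f)" "(1 + 3 * (p - q)) * m"] assms
    by (simp add: algebra_simps)
  have "hit m (l * e) (l * f)"
    using l(1) 1 2 by (intro hitI1[of _ q _ _ p]) (simp_all add: algebra_simps)
  then show ?thesis unfolding good_def by blast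
qed

text \<open>The same for the left triangle, with the last multiple that does not cross its edge
  \<open>x = 1/3\<close>.\<close>

lemma good_triangle2:
  assumes "0 < f" "f < e"
    and "(3 * (p - q) - 1) * m * e \<le> ((1 + 3 * p) * m - 3 * e) * (e - f)"
    and "(2 + 3 * p + 3 * q) * m * e \<le> ((1 + 3 * p) * m - 3 * e) * (e + f)"
  shows "good m e f"
proof -
  have B: "0 < 3 * e" using assms by simp
  obtain l' where l': "- ((1 + 3 * p) * m) \<le> l' * (3 * e)"
      "l' * (3 * e) < - ((1 + 3 * p) * m) + 3 * e"
    using ceiling_multiple[OF B] by blast
  define l where "l = - l'"
  have l: "l * (3 * e) \<le> (1 + 3 * p) * m" "(1 + 3 * p) * m - 3 * e \<le> l * (3 * e)"
    using l' by (simp_all add: l_def)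
  have 1: "(3 * (p - q) - 1) * m \<le> l * (3 * (e - f))"
    using mult_bound_below[OF l(2) B, of "3 * (e - f)" "(3 * (p - q) - 1) * m"] assms
    by (simp add: algebra_simps)
  have 2: "(2 + 3 * p + 3 * q) * m \<le> l * (3 * (e + f))"
    using mult_bound_below[OF l(2) B, of "3 * (e + f)" "(2 + 3 * p + 3 * q) * m"] assms
    by (simp add: algebra_simps)
  have "hit m (l * e) (l * f)"
    using l(1) 1 2 by (intro hitI2[of _ p _ _ q]) (simp_all add: algebra_simps)
  then show ?thesis unfolding good_def by blast
qed

text \<open>The same for the shifted right triangle, with the first multiple past its edge
  \<open>x = -1/3\<close>.\<close>

lemma good_triangle3:
  assumes "0 < f" "f < e"
    and "((3 * p - 1) * m + 3 * e) * (e + f) \<le> (1 + 3 * p + 3 * q) * m * e"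
    and "((3 * p - 1) * m + 3 * e) * (e - f) \<le> (3 * (p - q) - 2) * m * e"
  shows "good m e f"
proof -
  have B: "0 < 3 * e" using assms by simp
  obtain l where l: "(3 * p - 1) * m \<le> l * (3 * e)"
      "l * (3 * e) < (3 * p - 1) * m + 3 * e"
    using ceiling_multiple[OF B] by blast
  have 1: "l * (3 * (e + f)) \<le> (1 + 3 * p + 3 * q) * m"
    using mult_bound_above[OF less_imp_le[OF l(2)] B, of "3 * (e + f)" "(1 + 3 * p + 3 * q) * m"] assms
    by (simp add: algebra_simps)
  have 2: "l * (3 * (e - f)) \<le> (3 * (p - q) - 2) * m"
    using mult_bound_above[OF less_imp_le[OF l(2)] B, of "3 * (e - f)" "(3 * (p - q) - 2) * m"] assms
    by (simp add: algebra_simps)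
  have "hit m (l * e) (l * f)"
    using l(1) 1 2 by (intro hitI3[of _ _ p _ q]) (simp_all add: algebra_simps)
  then show ?thesis unfolding good_def by blast
qed

text \<open>Steps are short against the triangles, so each range of slopes \<open>f / e\<close> gets
  a triangle that the ray crosses in a long segment. The breakpoints lie where both neighbouring
  choices are admissible.\<close>

lemma good_of_large_ratio:
  assumes "0 < f" "f < e" and m: "13 * e \<le> m"
  shows "good m e f"
proof -
  have e: "0 < e" using assms by simp
  \<comment> \<open>Turns the quadratic hypotheses of the triangle lemmas into linear inequalities
    \<open>Z \<le> 13 * X\<close> in \<open>e\<close> and \<open>f\<close>.\<close>
  have key: "Y \<le> m * X" if "0 \<le> X" "Y \<le> e * Z" "Z \<le> 13 * X" for X Y Z
  proof -
    have "e * Z \<le> e * (13 * X)" using that e by (intro mult_left_mono) auto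
    also have "\<dots> = 13 * e * X" by simp
    also have "\<dots> \<le> m * X" using that(1) m by (intro mult_right_mono) auto
    finally show ?thesis using that(2) by linarith
  qed
  have sq: "(e - f) * (e + f) \<le> e * e" by (simp add: algebra_simps)
  have ff: "f * (e + f) \<le> f * (2 * e)" using assms by (intro mult_left_mono) auto
  consider "117 * f \<le> 16 * e" | "117 * f > 16 * e" "88 * f \<le> 16 * e"
    | "88 * f > 16 * e" "88 * f \<le> 23 * e" | "88 * f > 23 * e" "68 * f \<le> 23 * e"
    | "68 * f > 23 * e" "49 * f \<le> 23 * e" | "49 * f > 23 * e" "29 * f < 16 * e"
    | "29 * f \<ge> 16 * e" "29 * f \<le> 23 * e" | "29 * f > 23 * e" "7 * f \<le> 6 * e"
    | "7 * f > 6 * e" by linarith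
  then show ?thesis
  proof cases
    case 1
    have "0 < 78 * f" using assms by simp
    \<comment> \<open>For slopes near 0 the shift depends on the slope: \<open>p\<close> is least
      with \<open>16 * e \<le> 39 * f + 78 * p * f\<close>, which is the second inequality below;
      minimality gives the first.\<close>
    then obtain p where p: "16 * e - 39 * f \<le> p * (78 * f)" "p * (78 * f) < 16 * e - 39 * f + 78 * f"
      using ceiling_multiple by blast
    define w where "w = p * f"
    have w: "16 * e - 39 * f \<le> 78 * w" "78 * w < 16 * e + 39 * f"
      using p by (simp_all add: w_def algebra_simps)
    have "3 * f * (e + f) \<le> m * (e - (f + 3 * w))"
    proof (rule key[where Z = "4 * f"])
      show "3 * f * (e + f) \<le> e * (4 * f)"
        using mult_left_mono[of "3 * f" e f] 1 assms by (simp add: algebra_simps)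
    qed (use w 1 assms in simp_all)
    moreover have "3 * ((e - f) * (e + f)) \<le> m * (3 * f + 6 * w - e)"
      by (rule key[where Z = "3 * e"]) (use w e sq in \<open>simp_all add: algebra_simps\<close>)
    ultimately show ?thesis
      using assms by (intro good_triangle1[of f e p 0 m]) (simp_all add: w_def algebra_simps)
  next
    case 2
    have "3 * f * (e + f) \<le> m * (e - 4 * f)"
      by (rule key[where Z = "6 * f"]) (use 2 ff in \<open>simp_all add: algebra_simps\<close>)
    moreover have "3 * ((e - f) * (e + f)) \<le> m * (9 * f - e)"
      by (rule key[where Z = "3 * e"]) (use 2 sq in \<open>simp_all add: algebra_simps\<close>)
    ultimately show ?thesis
      using assms by (intro good_triangle1[of f e 1 0 m]) (simp_all add: algebra_simps)
  next
    case 3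
    have "3 * e * (e - f) \<le> m * (2 * e - 7 * f)"
      by (rule key[where Z = "3 * (e - f)"]) (use 3 e in \<open>simp_all add: algebra_simps\<close>)
    moreover have "3 * e * (e + f) \<le> m * (7 * f - e)"
      by (rule key[where Z = "3 * (e + f)"]) (use 3 e in \<open>simp_all add: algebra_simps\<close>)
    ultimately show ?thesis
      using assms by (intro good_triangle2[of f e 2 0 m]) (simp_all add: algebra_simps)
  next
    case 4
    have "3 * e * (e + f) \<le> m * (2 * e - 5 * f)"
      by (rule key[where Z = "3 * (e + f)"]) (use 4 e in \<open>simp_all add: algebra_simps\<close>)
    moreover have "3 * e * (e - f) \<le> m * (5 * f - e)"
      by (rule key[where Z = "3 * (e - f)"]) (use 4 e in \<open>simp_all add: algebra_simps\<close>)
    ultimately show ?thesis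
      using assms by (intro good_triangle3[of f e 2 m 0]) (simp_all add: algebra_simps)
  next
    case 5
    have "3 * e * (e - f) \<le> m * (2 * e - 4 * f)"
      by (rule key[where Z = "3 * (e - f)"]) (use 5 e in \<open>simp_all add: algebra_simps\<close>)
    moreover have "3 * e * (e + f) \<le> m * (4 * f - e)"
      by (rule key[where Z = "3 * (e + f)"]) (use 5 e in \<open>simp_all add: algebra_simps\<close>)
    ultimately show ?thesis
      using assms by (intro good_triangle2[of f e 1 0 m]) (simp_all add: algebra_simps)
  next
    case 6
    have "3 * f * (e + f) \<le> m * (e - f)"
      by (rule key[where Z = "6 * f"]) (use 6 ff in \<open>simp_all add: algebra_simps\<close>)
    moreover have "3 * ((e - f) * (e + f)) \<le> m * (3 * f - e)"
      by (rule key[where Z = "3 * e"]) (use 6 sq in \<open>simp_all add: algebra_simps\<close>)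
    ultimately show ?thesis
      using assms by (intro good_triangle1[of f e 0 0 m]) (simp_all add: algebra_simps)
  next
    case 7
    have "3 * e * (e + f) \<le> m * (2 * e - 2 * f)"
      by (rule key[where Z = "3 * (e + f)"]) (use 7 e in \<open>simp_all add: algebra_simps\<close>)
    moreover have "3 * e * (e - f) \<le> m * (2 * f - e)"
      by (rule key[where Z = "3 * (e - f)"]) (use 7 e in \<open>simp_all add: algebra_simps\<close>)
    ultimately show ?thesis
      using assms by (intro good_triangle3[of f e 1 m 0]) (simp_all add: algebra_simps)
  next
    case 8
    have "3 * f * (e + f) \<le> m * (4 * (e - f))"
      by (rule key[where Z = "6 * f"]) (use 8 ff in \<open>simp_all add: algebra_simps\<close>)
    moreover have "3 * ((e - f) * (e + f)) \<le> m * (9 * f - 7 * e)"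
    proof (rule key[where Z = "6 * (e - f)"])
      show "3 * ((e - f) * (e + f)) \<le> e * (6 * (e - f))"
        using mult_left_mono[of "e + f" "2 * e" "3 * (e - f)"] assms by (simp add: algebra_simps)
    qed (use 8 in \<open>simp_all add: algebra_simps\<close>)
    ultimately show ?thesis
      using assms by (intro good_triangle1[of f e 1 1 m]) (simp_all add: algebra_simps)
  next
    case 9
    define h where "h = e - f"
    have h: "0 < h" "7 * h < e" "f = e - h" using 9 assms by (simp_all add: h_def)
    have "0 < 39 * h" using h by simp
    \<comment> \<open>Near the diagonal the shift is \<open>(q, q)\<close>, with \<open>q\<close>
      least such that \<open>6 * e \<le> 13 * h + 39 * q * h\<close>, which yields the first
      inequality below.\<close>
    then obtain q where q: "6 * e - 13 * h \<le> q * (39 * h)" "q * (39 * h) < 6 * e - 13 * h + 39 * h"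
      using ceiling_multiple by blast
    define w where "w = q * h"
    have w: "6 * e - 13 * h \<le> 39 * w" "39 * w < 6 * e + 26 * h"
      using q by (simp_all add: w_def algebra_simps)
    have "3 * f * (e + f) \<le> m * (h + 3 * w)"
    proof (rule key[where Z = "6 * e"])
      show "3 * f * (e + f) \<le> e * (6 * e)"
        using mult_mono[of f e "e + f" "2 * e"] assms by simp
    qed (use w e in simp_all)
    moreover have "3 * (h * (e + f)) \<le> m * (2 * e - 3 * h - 6 * w)"
    proof (rule key[where Z = "6 * h"])
      show "3 * (h * (e + f)) \<le> e * (6 * h)"
        using mult_left_mono[of "e + f" "2 * e" "3 * h"] h by (simp add: algebra_simps)
    qed (use w h in simp_all)
    ultimately show ?thesis
      using assms by (intro good_triangle1[of f e q q m]) (simp_all add: w_def h_def algebra_simps)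
  qed
qed

section \<open>Lattices with a short vector on an axis or a diagonal\<close>

text \<open>Two multipliers span the lattice modulo \<open>m\<close>: the Bezout coefficient
  \<open>s\<close> gives \<open>(s * x, g)\<close>, and \<open>r * n\<close> gives
  \<open>(r, 0)\<close> because \<open>n * x + k * g = 1\<close>. So the row at height
  \<open>i * g\<close> contains a full progression of difference \<open>r\<close>.\<close>

lemma multiples_lattice:
  fixes x y m :: int
  assumes "0 < m" and cop: "gcd x (gcd y m) = 1" and g: "g = gcd y m" and r: "m = r * g"
  obtains u where "0 \<le> u" "u < r"
    and "\<And>i w. \<exists>j. [j * x = i * u + w * r] (mod m) \<and> [j * y = i * g] (mod m)"
proof -
  have "0 < g" using g assms(1) by simp
  then have "0 < r" using r assms(1) by (simp add: zero_less_mult_iff)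
  obtain s t where st: "s * y + t * m = g" using bezout_int g by metis
  obtain n k where nk: "n * x + k * g = 1" using bezout_int cop g by metis
  have "g dvd y" using g by simp
  then obtain z where z: "r * y = m * z" by (auto simp: r)
  define u where "u = (s * x) mod r"
  define d where "d = (s * x) div r"
  have sx: "s * x = d * r + u" by (simp add: u_def d_def)
  show ?thesis
  proof (rule that)
    show "0 \<le> u" "u < r" using \<open>0 < r\<close> by (simp_all add: u_def)
    fix i w
    define c where "c = w - i * d"
    define j where "j = i * s + c * r * n"
    have "j * x = i * (s * x) + c * r * (n * x + k * g) - c * k * (r * g)"
      by (simp add: j_def algebra_simps)
    also have "\<dots> = i * u + w * r + (- (c * k)) * m"
      unfolding nk sx r c_def by (simp add: algebra_simps)
    finally have 1: "[j * x = i * u + w * r] (mod m)"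
      by (auto simp: cong_iff_lin intro!: exI[of _ "c * k"])
    have "j * y = i * (s * y + t * m) + c * n * (r * y) - i * t * m"
      by (simp add: j_def algebra_simps)
    also have "\<dots> = i * g + (c * n * z - i * t) * m"
      unfolding st z by (simp add: algebra_simps)
    finally have "[j * y = i * g] (mod m)"
      by (auto simp: cong_iff_lin algebra_simps intro!: exI[of _ "i * t - c * n * z"])
    with 1 show "\<exists>j. [j * x = i * u + w * r] (mod m) \<and> [j * y = i * g] (mod m)" by blast
  qed
qed

lemma multiple_in_window:
  fixes x y m :: int
  assumes "0 < m" and "gcd x (gcd y m) = 1" and g: "g = gcd y m" and r: "m = r * g"
  obtains j u where "lo \<le> u" "u < lo + r" "[j * x = u] (mod m)" "[j * y = i * g] (mod m)"
proof -
  obtain u where u: "0 \<le> u" "u < r"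
    and j: "\<And>i w. \<exists>j. [j * x = i * u + w * r] (mod m) \<and> [j * y = i * g] (mod m)"
    using multiples_lattice[OF assms] by blast
  have "0 < r" using u by simp
  then obtain w where w: "lo - i * u \<le> w * r" "w * r < lo - i * u + r"
    using ceiling_multiple by blast
  obtain j where "[j * x = i * u + w * r] (mod m)" "[j * y = i * g] (mod m)" using j by blast
  with w show ?thesis by (intro that[of "i * u + w * r" j]) auto
qed

text \<open>A lattice point \<open>(e, 0)\<close> forces \<open>r\<close> to divide
  \<open>e\<close>, so \<open>r \<le> e\<close> and \<open>g = m / r\<close> exceeds
  \<open>k\<close>.\<close>

lemma order_less:
  fixes x y m :: int
  assumes "0 < m" and cop: "gcd x (gcd y m) = 1" and g: "g = gcd y m" and r: "m = r * g"
    and "[j * y = 0] (mod m)" "[j * x = e] (mod m)" "0 < e" "e * k < m"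
  shows "k < g"
proof -
  have "0 < g" using g assms(1) by simp
  then have "0 < r" using r assms(1) by (simp add: zero_less_mult_iff)
  obtain s t where st: "s * y + t * m = g" using bezout_int g by metis
  have "m dvd j * y" using assms(5) by (simp add: cong_0_iff)
  then have "m dvd s * (j * y) + j * t * m" by simp
  also have "\<dots> = j * (s * y + t * m)" by (simp add: algebra_simps)
  finally have "m dvd j * g" by (simp only: st)
  then have "r * g dvd j * g" by (simp only: r)
  then have "r dvd j" using \<open>0 < g\<close> by simp
  moreover have "r dvd m" using r by simp
  ultimately have "r dvd e" using assms(6)
    by (metis cong_dvd_modulus cong_dvd_iff dvd_mult2)
  then have "r \<le> e" using \<open>0 < e\<close> by (rule zdvd_imp_le)
  show ?thesis
  proof (rule ccontr)
    assume "\<not> k < g"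
    then have "r * g \<le> e * k" using \<open>r \<le> e\<close> \<open>0 < g\<close> \<open>0 < r\<close> by (intro mult_mono) auto
    then show False using assms(8) r by simp
  qed
qed

definition hit_code :: "int \<Rightarrow> int \<Rightarrow> int \<Rightarrow> bool" where
  "hit_code m u v = (let U = \<bar>2 * (u mod m) - m\<bar>; V = \<bar>2 * (v mod m) - m\<bar> in
     m \<le> 3 * max U V \<and> 3 * (U + V) \<le> 2 * m)"

lemma hit_code: "hit_code m u v \<Longrightarrow> hit m u v"
proof -
  have "2 * u - (2 * (u div m) + 1) * m = 2 * (u mod m) - m" for u
    by (simp add: algebra_simps minus_mult_div_eq_mod[symmetric])
  then show "hit m u v" if "hit_code m u v"
    using that unfolding hit_def hit_code_def Let_def
    by - (rule exI[of _ "u div m"], rule exI[of _ "v div m"], simp)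
qed

text \<open>With five rows and small \<open>g\<close>, the segments cut from the triangles are too
  short for the window argument; the rows are searched directly.\<close>

lemma window_code5_axis:
  "\<forall>g\<in>set [8..14]. \<forall>u\<in>set [0..4]. \<exists>i\<in>set [1..4]. \<exists>w\<in>set [0..g - 1].
     hit_code (5 * g) (5 * w + i * u) (i * g)"
  by code_simp

lemma window_code5_diagonal:
  "\<forall>u\<in>set [0..4::int]. \<exists>i\<in>set [1..4]. \<exists>w\<in>set [0..7].
     hit_code 40 (5 * w + i * u) (5 * w + i * u - i * 8)"
  by code_simp

text \<open>The row \<open>v = i * g\<close> next below \<open>m / 3\<close> meets the lower
  triangle from \<open>2 * m / 3 - v\<close> to \<open>m / 3 + v\<close>, and its points are
  \<open>r\<close> apart. Only \<open>r = 2\<close> and \<open>r = 5\<close> need separate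
  treatment.\<close>

lemma good_of_axis_multiple:
  fixes x y m :: int
  assumes m: "37 \<le> m" and cop: "gcd x (gcd y m) = 1" and y: "\<not> m dvd y"
    and j: "[j * x = e] (mod m)" "[j * y = 0] (mod m)" "0 < e" "e * k < m" and k: "6 \<le> k"
  shows "good m x y"
proof -
  have "0 < m" using m by simp
  define g where "g = gcd y m"
  obtain r where r: "m = r * g" unfolding g_def by (metis dvdE gcd_dvd2 mult.commute)
  have "0 < g" using \<open>0 < m\<close> by (simp add: g_def)
  then have "0 < r" using r \<open>0 < m\<close> by (simp add: zero_less_mult_iff)
  have "r \<noteq> 1" using r y g_def by (metis gcd_dvd1 mult_1)
  then have r2: "2 \<le> r" using \<open>0 < r\<close> by simp
  have g7: "7 \<le> g"
    using order_less[OF \<open>0 < m\<close> cop g_def r j(2,1,3,4)] k by simp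
  note win = multiple_in_window[OF \<open>0 < m\<close> cop g_def r]
  consider "r = 2" | "r = 5" "14 \<le> g" | "r = 5" "g < 14" | "r \<noteq> 2" "r \<noteq> 5" by linarith
  then show ?thesis
  proof cases
    \<comment> \<open>The middle row \<open>g = m / 2\<close> crosses the left triangle from
      \<open>g / 3\<close> to \<open>2 * g / 3\<close>.\<close>
    case 1
    obtain j u where u: "(g + 2) div 3 \<le> u" "u < (g + 2) div 3 + r"
      "[j * x = u] (mod m)" "[j * y = 1 * g] (mod m)" using win by blast
    have "hit m u (1 * g)"
      by (rule hitI2[of _ 0 _ _ 0]; use u(1,2) g7 r 1 in simp; presburger)
    then show ?thesis using u(3,4) by (rule goodI)
  next
    \<comment> \<open>The row \<open>g = m / 5\<close> meets the lower triangle from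
      \<open>7 * g / 3\<close> to \<open>8 * g / 3\<close>.\<close>
    case 2
    obtain j u where u: "(7 * g + 2) div 3 \<le> u" "u < (7 * g + 2) div 3 + r"
      "[j * x = u] (mod m)" "[j * y = 1 * g] (mod m)" using win by blast
    have "hit m u (1 * g)"
      by (rule hitI1[of _ 0 _ _ 0]; use u(1,2) 2 r in simp; presburger)
    then show ?thesis using u(3,4) by (rule goodI)
  next
    case 3
    obtain u where u: "0 \<le> u" "u < r"
      and j: "\<And>i w. \<exists>j. [j * x = i * u + w * r] (mod m) \<and> [j * y = i * g] (mod m)"
      using multiples_lattice[OF \<open>0 < m\<close> cop g_def r] by blast
    have "g \<in> set [8..14]" "u \<in> set [0..4]" using 3 m r u by auto
    then obtain i w where "hit_code (5 * g) (5 * w + i * u) (i * g)"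
      using window_code5_axis by blast
    then have "hit m (i * u + w * r) (i * g)"
      using hit_code 3 r by (simp add: algebra_simps)
    then show ?thesis using j goodI by blast
  next
    case 4
    define i where "i = r div 3"
    define v where "v = i * g"
    have i: "1 \<le> i" "r = 3 * i \<or> r = 3 * i + 1 \<or> r = 3 * i + 2 \<and> 2 \<le> i"
      using r2 4 unfolding i_def by presburger+
    have ig: "7 * i \<le> v" using g7 i(1) by (simp add: v_def)
    have ig2: "g + 7 * (i - 1) \<le> v"
      using mult_right_mono[of 7 g "i - 1"] g7 i(1) by (simp add: v_def algebra_simps)
    have ig3: "2 * g + 7 * (i - 2) \<le> v" if "2 \<le> i"
      using mult_right_mono[of 7 g "i - 2"] g7 that by (simp add: v_def algebra_simps)
    \<comment> \<open>The second bound says that the length \<open>2 * v - m / 3\<close> is at least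
      \<open>r\<close>, up to rounding, whence the \<open>+ 1\<close>.\<close>
    have v: "3 * v \<le> m" "m + 3 * r \<le> 6 * v + 1"
      using i(2) ig ig2 ig3 i(1) g7 by (auto simp: r v_def algebra_simps)
    obtain j u where u: "(2 * m - 3 * v + 2) div 3 \<le> u" "u < (2 * m - 3 * v + 2) div 3 + r"
      "[j * x = u] (mod m)" "[j * y = i * g] (mod m)" using win by blast
    have "hit m u v"
      by (rule hitI1[of _ 0 _ _ 0]; use u(1,2) v in simp; presburger)
    then show ?thesis using u(3,4) goodI unfolding v_def by blast
  qed
qed

text \<open>Passing to \<open>(x, x - y)\<close> turns the diagonal into an axis. The line
  \<open>x - y = v\<close> meets the lower triangle for \<open>x\<close> from
  \<open>m / 3 + v / 2\<close> to \<open>m / 3 + v\<close>. The hypothesis on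
  \<open>2 * (x - y)\<close> gives \<open>r \<ge> 3\<close>, so that \<open>i = r div 3\<close> is
  positive.\<close>

lemma good_of_diagonal_multiple:
  fixes x y m :: int
  assumes m: "37 \<le> m" and cop: "gcd x (gcd y m) = 1" and y: "\<not> m dvd 2 * (x - y)"
    and j: "[j * x = e] (mod m)" "[j * y = e] (mod m)" "0 < e" "e * k < m"
    and k: "6 \<le> k" "m \<le> (k + 1)\<^sup>2"
  shows "good m x y"
proof -
  have "0 < m" using m by simp
  define z where "z = x - y"
  define g where "g = gcd z m"
  have cop': "gcd x (gcd z m) = 1"
  proof -
    have "is_unit (gcd x (gcd z m))"
    proof -
      have "gcd x (gcd z m) dvd x" "gcd x (gcd z m) dvd z" "gcd x (gcd z m) dvd m"
        by (meson dvd_trans gcd_dvd1 gcd_dvd2)+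
      moreover from this have "gcd x (gcd z m) dvd y"
        using dvd_diff[of "gcd x (gcd z m)" x z] by (simp add: z_def)
      ultimately have "gcd x (gcd z m) dvd gcd x (gcd y m)" by simp
      then show ?thesis using cop by simp
    qed
    then show ?thesis by simp
  qed
  obtain r where r: "m = r * g" unfolding g_def by (metis dvdE gcd_dvd2 mult.commute)
  have "0 < g" using \<open>0 < m\<close> by (simp add: g_def)
  then have "0 < r" using r \<open>0 < m\<close> by (simp add: zero_less_mult_iff)
  have "\<not> m dvd 2 * g"
  proof
    assume "m dvd 2 * g"
    also have "2 * g dvd 2 * z" by (simp add: g_def)
    finally show False using y by (simp add: z_def)
  qed
  then have "r \<noteq> 1" "r \<noteq> 2" using r by auto
  then have r3: "3 \<le> r" using \<open>0 < r\<close> by simp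
  have jz: "[j * z = 0] (mod m)"
    using cong_diff[OF j(1,2)] by (simp add: z_def algebra_simps)
  have gk: "k < g"
    using order_less[OF \<open>0 < m\<close> cop' g_def r jz j(1,3,4)] by simp
  have g8: "8 \<le> g" if "50 \<le> m"
  proof (rule ccontr)
    assume "\<not> 8 \<le> g"
    then have "k = 6" using gk k by simp
    then show False using k(2) that by simp
  qed
  have diff: "[j * y = u - v] (mod m)" if "[j * x = u] (mod m)" "[j * z = v] (mod m)" for j u v
    using cong_diff[OF that] by (simp add: z_def algebra_simps)
  note win = multiple_in_window[OF \<open>0 < m\<close> cop' g_def r]
  show ?thesis
  proof (cases "r = 5 \<and> g = 8")
    case True
    obtain u where u: "0 \<le> u" "u < r"
      and j: "\<And>i w. \<exists>j. [j * x = i * u + w * r] (mod m) \<and> [j * z = i * g] (mod m)"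
      using multiples_lattice[OF \<open>0 < m\<close> cop' g_def r] by blast
    have "u \<in> set [0..4]" using True u by auto
    then obtain i w where "hit_code 40 (5 * w + i * u) (5 * w + i * u - i * 8)"
      using window_code5_diagonal by blast
    then have "hit m (i * u + w * r) (i * u + w * r - i * g)"
      using hit_code True r by (simp add: algebra_simps)
    then show ?thesis using j goodI diff by blast
  next
    case False
    define i where "i = r div 3"
    define v where "v = i * g"
    have i: "1 \<le> i" "3 * i \<le> r" "r \<le> 3 * i + 2" using r3 unfolding i_def by presburger+
    have v0: "3 * v \<le> m" using i(2) \<open>0 < g\<close> mult_right_mono[of "3 * i" r g] by (simp add: v_def r)
    have ig: "7 * i \<le> v" using gk k i(1) by (simp add: v_def)
    obtain j u where u: "(2 * m + 3 * v + 5) div 6 \<le> u" "u < (2 * m + 3 * v + 5) div 6 + r"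
      "[j * x = u] (mod m)" "[j * z = i * g] (mod m)" using win by blast
    have "3 * u \<le> m + 3 * v"
    proof (cases "6 * r \<le> 3 * v + 1")
      case True
      then show ?thesis using u(2) by presburger
    next
      \<comment> \<open>The segment can be too short only for \<open>i < 4\<close>. Among these few
        cases just \<open>(r, g) = (5, 9)\<close> remains, and there the rounding is
        favourable.\<close>
      case F: False
      have "i < 4" using F ig i by linarith
      then have "i = 1 \<or> i = 2 \<or> i = 3" using i by linarith
      moreover have "r = 3 * i \<or> r = 3 * i + 1 \<or> r = 3 * i + 2" using i by linarith
      ultimately have "r = 5 \<and> g = 9"
        using F False gk k(1) g8 m r unfolding v_def by (elim disjE) simp_all
      then show ?thesis using u(2) r by (simp add: v_def i_def)
    qed
    then have "hit m u (u - v)"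
      by - (rule hitI1[of _ 0 _ _ 0]; use u(1) v0 in simp; presburger)
    then show ?thesis using u(3) diff[OF u(3,4)] goodI unfolding v_def by blast
  qed
qed

section \<open>Parallelograms modulo large numbers\<close>

definition good_code :: "int \<Rightarrow> int \<Rightarrow> int \<Rightarrow> bool" where
  "good_code m x y \<longleftrightarrow> (\<exists>l\<in>set [1..m div 2]. hit_code m (l * x) (l * y))"

lemma good_code: "good_code m x y \<Longrightarrow> good m x y"
  unfolding good_code_def good_def using hit_code by blast

text \<open>If \<open>j * (x, y) = (e, f)\<close> and a prime \<open>d\<close> divides \<open>e\<close>, \<open>f\<close> and \<open>m\<close>, then \<open>d\<close> divides \<open>j\<close>, so one of the
  \<open>d\<close>-th parts of \<open>(e, f)\<close> modulo \<open>m\<close> is a multiple of \<open>(x, y)\<close> as well. This is needed for a handful of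
  triples \<open>(m, e, f)\<close> such as \<open>(40, 6, 2)\<close>, where \<open>(e, f)\<close> itself is not good.\<close>

definition multiple_code :: "int \<Rightarrow> int \<Rightarrow> int \<Rightarrow> bool" where
  "multiple_code m e f \<longleftrightarrow> good_code m e f \<or> (\<exists>d\<in>{2, 3}. d dvd e \<and> d dvd f \<and> d dvd m \<and>
     (\<forall>i\<in>set [0..d - 1]. \<forall>i'\<in>set [0..d - 1].
       let e' = e div d + i * (m div d); f' = f div d + i' * (m div d) in
       \<not> d dvd m div d \<and> d dvd e' \<and> d dvd f' \<or> good_code m e' f'))"

lemma good_of_multiple_code:
  fixes x y m :: int
  assumes "multiple_code m e f" and cop: "gcd x (gcd y m) = 1"
    and j: "[j * x = e] (mod m)" "[j * y = f] (mod m)"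
  shows "good m x y"
proof (cases "good_code m e f")
  case True
  then show ?thesis using good_mult[OF good_code j] by blast
next
  case False
  then obtain d where d: "d \<in> {2, 3}" "d dvd e" "d dvd f" "d dvd m"
    and c: "\<And>i i'. i \<in> set [0..d - 1] \<Longrightarrow> i' \<in> set [0..d - 1] \<Longrightarrow>
       \<not> d dvd m div d \<and> d dvd e div d + i * (m div d) \<and> d dvd f div d + i' * (m div d) \<or>
       good_code m (e div d + i * (m div d)) (f div d + i' * (m div d))"
    using assms(1) unfolding multiple_code_def Let_def by blast
  have "0 < d" using d(1) by auto
  obtain e' where e': "e = d * e'" using d by blast
  obtain f' where f': "f = d * f'" using d by blast
  obtain h where h: "m = d * h" using d by blast
  have dvd_j: "d dvd j" if "d dvd j * x" "d dvd j * y" for j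
  proof -
    obtain s t where st: "s * y + t * m = gcd y m" using bezout_int by metis
    obtain n k where nk: "n * x + k * gcd y m = 1" using bezout_int cop by metis
    have "j = n * (j * x) + k * s * (j * y) + k * t * j * m"
      using arg_cong[OF nk, of "(*) j"] unfolding st[symmetric] by (simp add: algebra_simps)
    moreover have "d dvd n * (j * x) + k * s * (j * y) + k * t * j * m"
      using that d(4) by simp
    ultimately show ?thesis by metis
  qed
  have dvd_cong: "d dvd z" if "[z = z'] (mod m)" "d dvd z'" for z z'
    using that d(4) by (meson cong_dvd_iff cong_dvd_modulus)
  have "d dvd j" using dvd_j dvd_cong j d by blast
  then obtain q where q: "j = d * q" by blast
  \<comment> \<open>Replacing \<open>q\<close> by \<open>q + h\<close> changes \<open>d * q\<close>
    by \<open>m\<close>, but destroys divisibility by \<open>d\<close> when \<open>d\<close> does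
    not divide \<open>h\<close>. This rules out the exempted pairs in
    \<open>multiple_code\<close>.\<close>
  obtain j' where j': "[j = d * j'] (mod m)" "d dvd h \<or> \<not> d dvd j'"
  proof (cases "d dvd q")
    case True
    show ?thesis
      by (rule that[of "q + h"]) (use True in \<open>auto simp: q h distrib_left dvd_add_right_iff cong_iff_dvd_diff\<close>)
  next
    case False
    show ?thesis by (rule that[of q]) (use False in \<open>auto simp: q\<close>)
  qed
  have part: "\<exists>i\<in>set [0..d - 1]. [j' * x = a' + i * h] (mod m)"
    if "[j * x = d * a'] (mod m)" for x a'
  proof -
    have "[d * j' * x = d * a'] (mod m)"
      using cong_trans[OF cong_sym[OF cong_scalar_right[OF j'(1)]] that] .
    then have "d * h dvd d * (j' * x - a')"
      by (simp add: cong_iff_dvd_diff h algebra_simps)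
    then have "h dvd j' * x - a'" using \<open>0 < d\<close> by simp
    then obtain z where z: "j' * x - a' = h * z" by blast
    have "j' * x - (a' + z mod d * h) = m * (z div d)"
      using z by (simp add: h algebra_simps minus_mult_div_eq_mod[symmetric])
    then have "[j' * x = a' + z mod d * h] (mod m)" by (simp add: cong_iff_dvd_diff)
    moreover have "z mod d \<in> set [0..d - 1]" using \<open>0 < d\<close> by simp
    ultimately show ?thesis by blast
  qed
  obtain i where i: "i \<in> set [0..d - 1]" "[j' * x = e' + i * h] (mod m)"
    using part[of x e'] j(1) e' by blast
  obtain i' where i': "i' \<in> set [0..d - 1]" "[j' * y = f' + i' * h] (mod m)"
    using part[of y f'] j(2) f' by blast
  have div: "e div d = e'" "f div d = f'" "m div d = h" using \<open>0 < d\<close> by (simp_all add: e' f' h)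
  have "good_code m (e' + i * h) (f' + i' * h)"
    using c[OF i(1) i'(1), unfolded div] dvd_j[OF dvd_cong[OF i(2)] dvd_cong[OF i'(2)]] j'(2) by blast
  from good_mult[OF good_code[OF this] i(2) i'(2)] show ?thesis .
qed

text \<open>Simultaneous Dirichlet approximation of \<open>x / m\<close> and \<open>y / m\<close>
  with error below \<open>1 / k\<close>, multiplied by \<open>m\<close>; denominators up to
  \<open>k^2\<close> stay below \<open>m\<close>.\<close>

lemma small_multiple:
  fixes x y m k :: int
  assumes "0 < k" "k\<^sup>2 < m"
  obtains j u v where "0 < j" "j < m" "[j * x = u] (mod m)" "[j * y = v] (mod m)"
    "\<bar>u\<bar> * k < m" "\<bar>v\<bar> * k < m"
proof -
  have "0 < nat k" using assms by simp
  define \<theta> where "\<theta> = (\<lambda>i::nat. real_of_int (if i = 0 then x else y) / real_of_int m)"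
  obtain q p where q: "0 < q" "q \<le> int (nat k ^ 2)"
    and p: "\<And>i. i < 2 \<Longrightarrow> \<bar>of_int q * \<theta> i - of_int (p i)\<bar> < 1 / real (nat k)"
    using Dirichlet_approx_simult[OF \<open>0 < nat k\<close>, of 2 \<theta>] by blast
  have m0: "0 < m" using assms by (smt (verit) zero_le_power2)
  have b: "\<bar>q * z - p i * m\<bar> * k < m" if "i < 2" "\<theta> i = real_of_int z / real_of_int m" for i z
  proof -
    have "\<bar>of_int q * \<theta> i - of_int (p i)\<bar> * (real_of_int m * real_of_int k)
        < 1 / real (nat k) * (real_of_int m * real_of_int k)"
      using p[OF that(1)] m0 assms by (intro mult_strict_right_mono) auto
    also have "\<dots> = real_of_int m" using assms by simp
    finally have "\<bar>of_int q * \<theta> i - of_int (p i)\<bar> * real_of_int m * real_of_int k < real_of_int m"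
      by (simp add: mult.assoc)
    also have "\<bar>of_int q * \<theta> i - of_int (p i)\<bar> * real_of_int m
        = \<bar>(of_int q * \<theta> i - of_int (p i)) * real_of_int m\<bar>"
      using m0 by (simp add: abs_mult)
    also have "(of_int q * \<theta> i - of_int (p i)) * real_of_int m = real_of_int (q * z - p i * m)"
      using m0 that(2) by (simp add: field_simps)
    finally have "real_of_int (\<bar>q * z - p i * m\<bar> * k) < real_of_int m" by simp
    then show ?thesis by (simp only: of_int_less_iff)
  qed
  show ?thesis
  proof (rule that[of q "q * x - p 0 * m" "q * y - p 1 * m"])
    show "q < m" using q(2) assms by simp
    show "\<bar>q * x - p 0 * m\<bar> * k < m" "\<bar>q * y - p 1 * m\<bar> * k < m"
      by (rule b; simp add: \<theta>_def)+
  qed (use q in \<open>simp_all add: cong_iff_dvd_diff\<close>)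
qed

text \<open>The vectors not reached by \<open>good_of_large_ratio\<close>: \<open>m < 13 * e\<close>
  and \<open>e * k < m\<close> together force \<open>k < 13\<close>.\<close>

definition table_code :: "int \<Rightarrow> bool" where
  "table_code k \<longleftrightarrow> (\<forall>m\<in>set [k * k + 1..(k + 1) * (k + 1)]. \<forall>e\<in>set [m div 13 + 1..(m - 1) div k].
     \<forall>f\<in>set [1..e - 1]. multiple_code m e f)"

lemma table_code: "\<forall>k\<in>set [6..12]. table_code k"
  by code_simp

lemma good_of_ordered_multiple:
  fixes x y m :: int
  assumes m: "37 \<le> m" and cop: "gcd x (gcd y m) = 1" and k: "6 \<le> k" "k\<^sup>2 < m" "m \<le> (k + 1)\<^sup>2"
    and nd: "\<not> m dvd y" "\<not> m dvd 2 * (x - y)"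
    and j: "[j * x = e] (mod m)" "[j * y = f] (mod m)"
    and ef: "0 < e" "0 \<le> f" "f \<le> e" "e * k < m"
  shows "good m x y"
proof -
  consider "f = 0" | "f = e" | "0 < f" "f < e" "13 * e \<le> m" | "0 < f" "f < e" "m < 13 * e"
    using ef by linarith
  then show ?thesis
  proof cases
    case 1
    show ?thesis using good_of_axis_multiple[OF m cop nd(1) j(1) _ ef(1,4) k(1)] j(2) 1 by simp
  next
    case 2
    show ?thesis
      using good_of_diagonal_multiple[OF m cop nd(2) j(1) _ ef(1,4) k(1,3)] j(2) 2 by simp
  next
    case 3
    show ?thesis using good_mult[OF good_of_large_ratio[OF 3] j] .
  next
    case 4
    have "k < 13"
    proof (rule ccontr)
      assume "\<not> k < 13"
      then have "e * 13 \<le> e * k" using ef by (intro mult_left_mono) auto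
      then show False using 4 ef by linarith
    qed
    then have "k \<in> set [6..12]" unfolding set_upto atLeastAtMost_iff using k(1) by presburger
    then have "table_code k" using table_code by blast
    moreover have "m \<in> set [k * k + 1..(k + 1) * (k + 1)]"
      using k by (simp add: power2_eq_square)
    moreover have "e \<in> set [m div 13 + 1..(m - 1) div k]"
    proof -
      have "e \<le> (m - 1) div k" using zdiv_mono1[of "e * k" "m - 1" k] ef(4) k(1) by simp
      moreover have "m div 13 + 1 \<le> e" using 4(3) by presburger
      ultimately show ?thesis by simp
    qed
    moreover have "f \<in> set [1..e - 1]" using 4 by simp
    ultimately have "multiple_code m e f" unfolding table_code_def by blast
    from good_of_multiple_code[OF this cop j] show ?thesis .
  qed
qed

lemma good_of_modulus_ge_37:
  fixes x y m :: int
  assumes m: "37 \<le> m" and cop: "gcd x (gcd y m) = 1"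
    and nd: "\<not> m dvd x" "\<not> m dvd y" "\<not> m dvd 2 * (x - y)" "\<not> m dvd 2 * (x + y)"
  shows "good m x y"
proof -
  \<comment> \<open>\<open>k^2 < m\<close> serves Dirichlet's theorem, and \<open>37 \<le> m\<close>
    makes \<open>k\<close> at least 6.\<close>
  define k where "k = int (floor_sqrt (nat (m - 1)))"
  have kk: "floor_sqrt (nat (m - 1)) ^ 2 \<le> nat (m - 1)" "nat (m - 1) < (floor_sqrt (nat (m - 1)) + 1) ^ 2"
    using floor_sqrt_power2_le[of "nat (m - 1)"] Suc_floor_sqrt_power2_gt[of "nat (m - 1)"] by simp_all
  have "int (floor_sqrt (nat (m - 1)) ^ 2) \<le> m - 1" using kk(1) m by linarith
  then have k1: "k\<^sup>2 < m" by (simp add: k_def)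
  have "m - 1 < int ((floor_sqrt (nat (m - 1)) + 1) ^ 2)" using kk(2) m by linarith
  then have k2: "m \<le> (k + 1)\<^sup>2" by (simp add: k_def add.commute)
  have k3: "6 \<le> k"
  proof (rule ccontr)
    assume "\<not> 6 \<le> k"
    then have "(k + 1)\<^sup>2 \<le> 6\<^sup>2" by (intro power_mono) (auto simp: k_def)
    then show False using k2 m by simp
  qed
  note k = k3 k1 k2
  obtain j u v where j: "0 < j" "j < m" "[j * x = u] (mod m)" "[j * y = v] (mod m)"
    "\<bar>u\<bar> * k < m" "\<bar>v\<bar> * k < m" using small_multiple[of k m x y] k by auto
  have signs: "good m x y" if g: "good m (s * x) (t * y)" "s \<in> {1, - 1}" "t \<in> {1, - 1}" for s t
  proof -
    have "good m x (t * y)" using g by (auto intro: good_neg)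
    then have "good m (t * y) x" by (rule good_swap)
    then have "good m y x" using g by (auto intro: good_neg)
    then show ?thesis by (rule good_swap)
  qed
  \<comment> \<open>Sign changes and a swap bring the short vector into the octant
    \<open>0 \<le> f \<le> e\<close>.\<close>
  define s t where "s = (if u < 0 then - 1 else 1::int)" and "t = (if v < 0 then - 1 else 1::int)"
  have st: "s \<in> {1, - 1}" "t \<in> {1, - 1}" by (auto simp: s_def t_def)
  have js: "[j * (s * x) = \<bar>u\<bar>] (mod m)" "[j * (t * y) = \<bar>v\<bar>] (mod m)"
    using cong_scalar_left[OF j(3), of s] cong_scalar_left[OF j(4), of t]
    by (auto simp: s_def t_def abs_if mult.left_commute split: if_splits)
  have cop': "gcd (s * x) (gcd (t * y) m) = 1" "gcd (t * y) (gcd (s * x) m) = 1"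
    using cop st by (auto simp: gcd.left_commute)
  have nd': "\<not> m dvd s * x" "\<not> m dvd t * y" "\<not> m dvd 2 * (s * x - t * y)"
    "\<not> m dvd 2 * (t * y - s * x)"
  proof -
    have "m dvd 2 * (y - x) \<longleftrightarrow> m dvd 2 * (x - y)" "m dvd 2 * (- x - y) \<longleftrightarrow> m dvd 2 * (x + y)"
      "m dvd 2 * (- y - x) \<longleftrightarrow> m dvd 2 * (x + y)" "m dvd 2 * (- x + y) \<longleftrightarrow> m dvd 2 * (x - y)"
      by (subst dvd_minus_iff[symmetric], simp add: algebra_simps)+
    then show "\<not> m dvd s * x" "\<not> m dvd t * y" "\<not> m dvd 2 * (s * x - t * y)"
      "\<not> m dvd 2 * (t * y - s * x)"
      using nd st by (auto simp: add.commute)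
  qed
  have uv: "0 < \<bar>u\<bar> \<or> 0 < \<bar>v\<bar>"
  proof (rule ccontr)
    assume "\<not> ?thesis"
    then have "m dvd j * x" "m dvd j * y" using j by (auto simp: cong_0_iff)
    then have "m dvd gcd (j * x) (gcd (j * y) (j * m))" by simp
    also have "\<dots> = j * gcd x (gcd y m)" using j(1) by (simp flip: gcd_mult_distrib_int)
    finally show False using cop j(1,2) zdvd_not_zless by simp
  qed
  have "good m (s * x) (t * y)"
  proof (cases "\<bar>v\<bar> \<le> \<bar>u\<bar>")
    case True
    show ?thesis
      by (rule good_of_ordered_multiple[OF m cop'(1) k nd'(2,3) js]) (use True uv j in auto)
  next
    case False
    show ?thesis
      by (rule good_swap, rule good_of_ordered_multiple[OF m cop'(2) k nd'(1,4) js(2,1)])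
        (use False uv j in auto)
  qed
  then show ?thesis using signs st by blast
qed

section \<open>Parallelograms with a diagonal of order two\<close>

text \<open>A colouring with period \<open>2 * a\<close> for \<open>{0, 1, a - 1, a}\<close>, the degenerate parallelogram whose diagonal has order two
  modulo \<open>2 * a\<close>. The positions in \<open>twos a\<close> form an independent dominating set of the path
  \<open>0, \<dots>, a - 1\<close>; they get colour 2 in both halves of the period, all other positions get colour 0 in
  the first half and colour 1 in the second.\<close>

definition twos :: "int \<Rightarrow> int \<Rightarrow> bool" where
  "twos a i \<longleftrightarrow> 1 \<le> i \<and> i \<le> a - 2 \<and> (if odd a then odd i else i = 1 \<or> even i \<and> 4 \<le> i)"

lemma twos_independent: "twos a i \<Longrightarrow> \<not> twos a (i + 1) \<and> \<not> twos a (i - 1)"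
  unfolding twos_def by (auto split: if_splits)

lemma twos_dominating:
  assumes "5 \<le> a" "0 \<le> i" "i < a" "\<not> twos a i"
  shows "twos a (i + 1) \<or> twos a (i - 1)"
  using assms unfolding twos_def by (cases "odd a") (simp_all, presburger+)

definition half_coloring :: "int \<Rightarrow> int \<Rightarrow> nat" where
  "half_coloring a n = (if twos a (n mod a) then 2 else if n mod (2 * a) < a then 0 else 1)"

lemma half_coloring_cong: "[n = n'] (mod 2 * a) \<Longrightarrow> half_coloring a n = half_coloring a n'"
  using cong_dvd_modulus[of n n' "2 * a" a] by (simp add: half_coloring_def cong_def)

text \<open>If \<open>n mod a\<close> is in \<open>twos\<close>, independence leaves the two half
  colours to \<open>n + 1\<close> and \<open>n + a - 1\<close>. Otherwise \<open>n\<close> and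
  \<open>n + a\<close> carry them, and domination supplies colour 2.\<close>

lemma half_coloring_window:
  assumes a: "5 \<le> a" and "c < 3"
  shows "\<exists>s\<in>{0, 1, a - 1, a}. half_coloring a (n + s) = c"
proof -
  define i where "i = n mod a"
  define h where "h = n div a mod 2"
  have i: "0 \<le> i" "i < a" using a by (simp_all add: i_def)
  have h: "h = 0 \<or> h = 1" unfolding h_def by presburger
  have n: "[n = i + h * a] (mod 2 * a)"
  proof -
    have "n - (i + h * a) = a * (n div a - h)" by (simp add: i_def algebra_simps minus_div_mult_eq_mod[symmetric])
    moreover have "2 dvd n div a - h" unfolding h_def by (rule dvd_minus_mod)
    ultimately show ?thesis by (simp add: cong_iff_dvd_diff mult.commute mult_dvd_mono)
  qed
  have val: "half_coloring a (n + s) = (if twos a d then 2 else if b = 0 then 0 else 1)"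
    if "[i + h * a + s = d + b * a] (mod 2 * a)" "0 \<le> d" "d < a" "b = 0 \<or> b = 1" for s d b
  proof -
    have "[n + s = d + b * a] (mod 2 * a)" using cong_add[OF n cong_refl] that(1) cong_trans by blast
    then have "half_coloring a (n + s) = half_coloring a (d + b * a)" by (rule half_coloring_cong)
    also have "(d + b * a) mod a = d" using that by simp
    moreover have "(d + b * a) mod (2 * a) = d + b * a" using that by (intro mod_pos_pos_trivial) auto
    ultimately show ?thesis using that by (auto simp: half_coloring_def)
  qed
  have v0: "half_coloring a (n + 0) = (if twos a i then 2 else if h = 0 then 0 else 1)"
    using val[of 0 i h] i h by simp
  have va: "half_coloring a (n + a) = (if twos a i then 2 else if 1 - h = 0 then 0 else 1)"
    using h by (intro val) (use i in \<open>auto simp: cong_iff_dvd_diff algebra_simps\<close>)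
  have v1: "half_coloring a (n + 1) = (if twos a (i + 1) then 2 else if h = 0 then 0 else 1)"
    if "i + 1 < a"
    using val[of 1 "i + 1" h] i h that by (simp add: algebra_simps)
  have vm: "half_coloring a (n + (a - 1)) = (if twos a (i - 1) then 2 else if 1 - h = 0 then 0 else 1)"
    if "0 < i"
    using h that by (intro val) (use i in \<open>auto simp: cong_iff_dvd_diff algebra_simps\<close>)
  have c: "c = 0 \<or> c = 1 \<or> c = 2" using assms(2) by auto
  show ?thesis
  proof (cases "twos a i")
    case True
    then have "0 < i" "i + 1 < a" by (auto simp: twos_def)
    then show ?thesis using True c h v0 v1 vm twos_independent[OF True] by auto
  next
    case False
    have "\<exists>s\<in>{0, 1, a - 1, a}. half_coloring a (n + s) = 2"
    proof (cases "twos a (i + 1)")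
      case True
      then show ?thesis using v1 by (auto simp: twos_def)
    next
      case F: False
      then have "twos a (i - 1)" using twos_dominating[OF a i False] by simp
      then show ?thesis using vm by (auto simp: twos_def)
    qed
    then show ?thesis using False c h v0 va by auto
  qed
qed

text \<open>Here the modulus \<open>b + c - a\<close> is \<open>2 * a\<close>. A unit
  \<open>h\<close> modulo \<open>2 * a\<close> is odd, hence fixes \<open>a\<close>, and it can be
  chosen to map the set to \<open>{0, 1, a - 1, a}\<close> or a translate.\<close>

lemma colorable3_order2_diagonal:
  fixes a b c :: int
  assumes a: "5 \<le> a" and bc: "b + c = 3 * a" and cop: "gcd a b = 1"
  shows "colorable3 {0, a, b, c}"
proof -
  define g where "g = (if odd b then b else b + a)"
  have "odd a \<or> odd b" using cop by (metis gcd_greatest is_unit_gcd odd_one dvd_def even_numeral)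
  then have g: "odd g" by (auto simp: g_def)
  have "coprime g a" using cop by (simp add: g_def coprime_iff_gcd_eq_1 gcd.commute add.commute[of b])
  then have "coprime g (2 * a)" using g by simp
  then obtain h where h: "[g * h = 1] (mod 2 * a)" using cong_solve_coprime_int by blast
  have "odd (g * h)" using h cong_dvd_modulus[OF h, of 2] by (auto simp: cong_def)
  then have "odd h" by simp
  then obtain w where w: "h = 2 * w + 1" by (elim oddE)
  have ha: "[h * a = a] (mod 2 * a)" by (simp add: w cong_iff_dvd_diff algebra_simps)
  have third: "[h * c = 3 * a - u] (mod 2 * a)" if "[h * b = u] (mod 2 * a)" for u
  proof -
    have "c = 3 * a - b" using bc by simp
    then have "h * c = 3 * (h * a) - h * b" by (simp only: right_diff_distrib mult.left_commute)
    then show ?thesis using cong_diff[OF cong_scalar_left[OF ha, of 3] that] by simp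
  qed
  have window: "\<exists>s\<in>{0, 1, a - 1, a}. half_coloring a (n + s) = i" if "i < 3" for n i
    using half_coloring_window[OF a that] .
  show ?thesis
  proof (rule colorable3I[of "\<lambda>n. half_coloring a (h * n)"])
    show "half_coloring a (h * n) < 3" for n by (simp add: half_coloring_def)
    fix n :: int and i :: nat assume i: "i < 3"
    show "\<exists>s\<in>{0, a, b, c}. half_coloring a (h * (n + s)) = i"
    proof (cases "odd b")
      case True
      have hb: "[h * b = 1] (mod 2 * a)" using h True by (simp add: g_def mult.commute)
      have hc: "[h * c = a - 1] (mod 2 * a)"
        by (rule cong_trans[OF third[OF hb]]) (simp add: cong_iff_dvd_diff)
      obtain s where s: "s \<in> {0, 1, a - 1, a}" "half_coloring a (h * n + s) = i"
        using window[OF i] by blast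
      have "\<exists>s'\<in>{0, a, b, c}. [h * s' = s] (mod 2 * a)" using s(1) ha hb hc by auto
      then obtain s' where s': "s' \<in> {0, a, b, c}" "[h * s' = s] (mod 2 * a)" by blast
      have "[h * (n + s') = h * n + s] (mod 2 * a)"
        using cong_add[OF cong_refl s'(2)] by (simp add: distrib_left)
      then show ?thesis using half_coloring_cong s(2) s'(1) by metis
    next
      case False
      have "[h * g - h * a = 1 - a] (mod 2 * a)"
        using cong_diff[OF h ha] by (simp add: mult.commute)
      moreover have "[1 - a = a + 1] (mod 2 * a)" by (simp add: cong_iff_dvd_diff)
      ultimately have hb: "[h * b = a + 1] (mod 2 * a)"
        using False cong_trans by (fastforce simp: g_def algebra_simps)
      have hc: "[h * c = - 1] (mod 2 * a)"
        by (rule cong_trans[OF third[OF hb]]) (simp add: cong_iff_dvd_diff)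
      \<comment> \<open>For even \<open>b\<close> the image is \<open>{0, a, a + 1, -1}\<close>, the
        standard set shifted by \<open>a\<close>.\<close>
      obtain s where s: "s \<in> {0, 1, a - 1, a}" "half_coloring a (h * n + a + s) = i"
        using window[OF i] by blast
      have "\<exists>s'\<in>{0, a, b, c}. [h * s' = a + s] (mod 2 * a)"
      proof -
        have "[h * c = a + (a - 1)] (mod 2 * a)"
          by (rule cong_trans[OF hc]) (simp add: cong_iff_dvd_diff)
        moreover have "[h * 0 = a + a] (mod 2 * a)" by (simp add: cong_iff_dvd_diff)
        ultimately show ?thesis using s(1) ha hb by auto
      qed
      then obtain s' where s': "s' \<in> {0, a, b, c}" "[h * s' = a + s] (mod 2 * a)" by blast
      have "[h * (n + s') = h * n + a + s] (mod 2 * a)"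
        using cong_add[OF cong_refl s'(2)] by (simp add: distrib_left add.assoc)
      then show ?thesis using half_coloring_cong s(2) s'(1) by metis
    qed
  qed
qed

section \<open>Small sets and conclusion\<close>

definition arcs_code :: "int list \<Rightarrow> int \<times> int \<Rightarrow> bool" where
  "arcs_code xs = (\<lambda>(N, t). \<forall>s\<in>set xs. \<exists>s'\<in>set xs.
     let d = (t * (s' - s)) mod N in 0 < d \<and> 3 * d \<le> N)"

text \<open>Pairs \<open>(N, t)\<close> standing for the winding \<open>n \<mapsto> t * n / N\<close>, found by a greedy covering search.\<close>

definition windings :: "(int \<times> int) list" where
  "windings = [(3, 1), (9, 2), (6, 1), (27, 13), (18, 5), (18, 1), (18, 7), (4, 1), (7, 3), (7, 1),
     (21, 2), (7, 2), (21, 5), (27, 5), (34, 7), (15, 4), (12, 1), (33, 5), (36, 13), (9, 4), (13, 4),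
     (21, 4), (9, 1), (15, 1), (19, 4), (21, 1), (27, 10), (33, 1), (14, 5)]"

text \<open>Triples with \<open>c - b < a\<close> are handled through their mirror image, and those
  with a common divisor are excluded by coprimality.\<close>

definition small_code :: "int \<Rightarrow> int \<Rightarrow> int \<Rightarrow> bool" where
  "small_code a b c \<longleftrightarrow> c - b < a \<or> (\<exists>w\<in>set windings. arcs_code [0, a, b, c] w) \<or>
     b + c = 3 * a \<and> 5 \<le> a \<or> c = 3 * b - a \<and> 5 \<le> c - b \<or>
     (\<exists>d\<in>{2, 3, 5, 7, 11}. d dvd a \<and> d dvd b \<and> d dvd c) \<or> a = 1 \<and> b = 7 \<and> c = 9"

lemma small_code:
  "\<forall>a\<in>set [1..33]. \<forall>b\<in>set [a + 1..35]. \<forall>c\<in>set [b + 1..36 + a - b]. small_code a b c"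
  by code_simp

lemma colorable3_arcs_code:
  assumes "arcs_code xs (N, t)" "0 < N" "xs \<noteq> []"
  shows "colorable3 (set xs)"
  using assms by (intro colorable3_arcs[of _ N t]) (auto simp: arcs_code_def Let_def)

lemma colorable3_0179: "colorable3 {0, 1, 7, 9}"
proof -
  \<comment> \<open>The period 15 is the modulus \<open>7 + 9 - 1\<close> of the
    parallelogram.\<close>
  define w :: "nat list" where "w = [0, 0, 0, 1, 0, 0, 1, 1, 1, 2, 2, 1, 2, 2, 2]"
  define c where "c n = w ! nat (n mod 15)" for n
  have chk: "\<forall>r\<in>set [0..14]. \<forall>i\<in>set [0..<3]. \<exists>s\<in>set [0, 1, 7, 9::int].
     [0, 0, 0, 1, 0, 0, 1, 1, 1, 2, 2, 1, 2, 2, 2::nat] ! nat ((r + s) mod 15) = i"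
    by code_simp
  show ?thesis
  proof (rule colorable3I[of c])
    fix n
    have "nat (n mod 15) < length w" by (simp add: w_def)
    then have "c n \<in> set w" unfolding c_def by (rule nth_mem)
    then show "c n < 3" by (auto simp: w_def)
  next
    fix n :: int and i :: nat assume i: "i < 3"
    have "n mod 15 \<in> set [0..14]" by simp
    moreover have "i \<in> set [0..<3]" using i by simp
    ultimately obtain s where "s \<in> set [0, 1, 7, 9]" "w ! nat ((n mod 15 + s) mod 15) = i"
      using chk unfolding w_def by blast
    then show "\<exists>s\<in>{0, 1, 7, 9}. c (n + s) = i" by (auto simp: c_def mod_add_left_eq)
  qed
qed

section \<open>Reflection and coprime normalization\<close>

lemma colorable3_reverse:
  assumes "colorable3 {0, c - b, c - a, c}"
  shows "colorable3 {0, a, b, c :: int}"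
proof -
  have "(+) c ` uminus ` {0, c - b, c - a, c} = {0, a, b, c}" by auto
  then show ?thesis using colorable3_translate[OF colorable3_reflect[OF assms], of c] by simp
qed

lemma gcd3_eq_1:
  fixes a b c x y z :: int
  assumes "gcd a (gcd b c) = 1"
    and "\<And>d. d dvd x \<Longrightarrow> d dvd y \<Longrightarrow> d dvd z \<Longrightarrow> d dvd a \<and> d dvd b \<and> d dvd c"
  shows "gcd x (gcd y z) = 1"
proof -
  have "gcd x (gcd y z) dvd x" "gcd x (gcd y z) dvd y" "gcd x (gcd y z) dvd z"
    by (meson dvd_trans gcd_dvd1 gcd_dvd2)+
  then have "gcd x (gcd y z) dvd gcd a (gcd b c)" using assms(2) by simp
  then show ?thesis using assms(1) by simp
qed

lemma gcd3_reverse: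
  fixes a b c :: int
  assumes "gcd a (gcd b c) = 1"
  shows "gcd (c - b) (gcd (c - a) c) = 1"
proof (rule gcd3_eq_1[OF assms])
  fix d assume "d dvd c - b" "d dvd c - a" "d dvd c"
  then show "d dvd a \<and> d dvd b \<and> d dvd c"
    using dvd_diff[of d c "c - a"] dvd_diff[of d c "c - b"] by simp
qed

text \<open>In the second alternative the other diagonal has order two,
  \<open>2 * (c - b) = b + c - a\<close>; the reflection \<open>n \<mapsto> c - n\<close> reduces it
  to the first.\<close>

lemma colorable3_order2_cases:
  fixes a b c :: int
  assumes "gcd a (gcd b c) = 1" and "b + c = 3 * a \<and> 5 \<le> a \<or> c = 3 * b - a \<and> 5 \<le> c - b"
  shows "colorable3 {0, a, b, c}"
proof -
  have main: "colorable3 {0, a, b, c}" if h: "gcd a (gcd b c) = 1" "b + c = 3 * a" "5 \<le> a" for a b c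
  proof -
    have "gcd a (gcd b b) = 1"
    proof (rule gcd3_eq_1[OF h(1)])
      fix d assume "d dvd a" "d dvd b"
      moreover have "c = 3 * a - b" using h(2) by simp
      ultimately show "d dvd a \<and> d dvd b \<and> d dvd c" by simp
    qed
    then have "gcd a b = 1" by simp
    then show ?thesis by (rule colorable3_order2_diagonal[OF h(3,2)])
  qed
  from assms(2) show ?thesis
  proof
    assume "b + c = 3 * a \<and> 5 \<le> a"
    then show ?thesis using main[OF assms(1)] by simp
  next
    assume h: "c = 3 * b - a \<and> 5 \<le> c - b"
    have "colorable3 {0, c - b, c - a, c}"
      by (rule main[OF gcd3_reverse[OF assms(1)]]) (use h in auto)
    then show ?thesis by (rule colorable3_reverse)
  qed
qed

lemma colorable3_small:
  fixes a b c :: int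
  assumes "0 < a" "a < b" "b < c" "gcd a (gcd b c) = 1" "b + c - a \<le> 36" "a \<le> c - b"
  shows "colorable3 {0, a, b, c}"
proof -
  have "a \<in> set [1..33]" "b \<in> set [a + 1..35]" "c \<in> set [b + 1..36 + a - b]" using assms by auto
  then have "small_code a b c" using small_code by blast
  moreover have "\<not> c - b < a" using assms(6) by simp
  ultimately consider w where "w \<in> set windings" "arcs_code [0, a, b, c] w"
    | "b + c = 3 * a \<and> 5 \<le> a \<or> c = 3 * b - a \<and> 5 \<le> c - b"
    | d where "d \<in> {2, 3, 5, 7, 11}" "d dvd a" "d dvd b" "d dvd c" | "a = 1" "b = 7" "c = 9"
    unfolding small_code_def by blast
  then show ?thesis
  proof cases
    case 1
    obtain N t where w: "w = (N, t)" by fastforce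
    have "0 < N" using 1(1) w by (auto simp: windings_def)
    then have "colorable3 (set [0, a, b, c])"
      using 1(2) unfolding w by (intro colorable3_arcs_code) auto
    then show ?thesis by simp
  next
    case 2
    then show ?thesis by (rule colorable3_order2_cases[OF assms(4)])
  next
    case 3
    then have "d dvd gcd a (gcd b c)" by simp
    then show ?thesis using 3(1) assms(4) by auto
  next
    case 4
    then show ?thesis using colorable3_0179 by simp
  qed
qed

lemma colorable3_normalized:
  fixes a b c :: int
  assumes abc: "0 < a" "a < b" "b < c" and cop: "gcd a (gcd b c) = 1"
  shows "colorable3 {0, a, b, c}"
proof -
  define m where "m = b + c - a"
  consider "m \<le> 36" "a \<le> c - b" | "m \<le> 36" "c - b < a" | "37 \<le> m" by linarith
  then show ?thesis
  proof cases
    case 1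
    then show ?thesis using colorable3_small assms by (simp add: m_def)
  next
    case 2
    have "colorable3 {0, c - b, c - a, c}"
      using 2 abc gcd3_reverse[OF cop] by (intro colorable3_small) (auto simp: m_def)
    then show ?thesis by (rule colorable3_reverse)
  next
    case 3
    show ?thesis
    proof (cases "b + c = 3 * a \<and> 5 \<le> a \<or> c = 3 * b - a \<and> 5 \<le> c - b")
      case True
      then show ?thesis by (rule colorable3_order2_cases[OF cop])
    next
      case False
      have eq: "2 * z = m" if z: "m dvd 2 * z" "0 < z" "z < m" for z
      proof -
        obtain q where q: "2 * z = m * q" using z(1) by blast
        have "0 < m * q" "m * q < m * 2" using q z by linarith+
        then have "0 < q" "q < 2" using 3 by (auto simp: zero_less_mult_iff)
        then have "q = 1" by simp
        then show ?thesis using q by simp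
      qed
      have 4: "\<not> m dvd 2 * (b - c)"
      proof
        assume "m dvd 2 * (b - c)"
        then have "m dvd 2 * (c - b)" by (subst dvd_minus_iff[symmetric]) (simp add: algebra_simps)
        then have "2 * (c - b) = m" using eq[of "c - b"] abc by (simp add: m_def)
        then show False using False 3 abc by (simp add: m_def)
      qed
      have 5: "\<not> m dvd 2 * (b + c)"
      proof
        assume "m dvd 2 * (b + c)"
        \<comment> \<open>Modulo \<open>m\<close> the diagonal \<open>b + c\<close> is
          \<open>a\<close>.\<close>
        then have "m dvd 2 * (b + c) - m * 2" by (intro dvd_diff) auto
        then have "m dvd 2 * a" by (simp add: m_def algebra_simps)
        then have "2 * a = m" using eq[of a] abc by (simp add: m_def)
        then show False using False 3 abc by (simp add: m_def)
      qed
      have "gcd b (gcd c m) = 1"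
      proof (rule gcd3_eq_1[OF cop])
        fix d assume d: "d dvd b" "d dvd c" "d dvd m"
        have "a = b + c - m" by (simp add: m_def)
        then show "d dvd a \<and> d dvd b \<and> d dvd c" using d by simp
      qed
      then have "good m b c"
        using 3 4 5 abc by (intro good_of_modulus_ge_37) (auto simp: m_def dest!: zdvd_imp_le)
      then show ?thesis
        using 3 abc by (intro colorable3_parallelogram[of m]) (auto simp: m_def)
    qed
  qed
qed

lemma colorable3_card_4:
  fixes S :: "int set"
  assumes "card S = 4"
  shows "colorable3 S"
proof -
  have "finite S" using assms by (metis card.infinite zero_neq_numeral)
  define l where "l = sorted_list_of_set S"
  have "length l = 4" using assms by (simp add: l_def)
  then obtain w x y z where l: "l = [w, x, y, z]"
    by (auto simp: numeral_eq_Suc length_Suc_conv)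
  have S: "S = {w, x, y, z}" using set_sorted_list_of_set[OF \<open>finite S\<close>] l l_def by simp
  have "sorted l" "distinct l" by (simp_all add: l_def)
  then have less: "w < x" "x < y" "y < z" by (auto simp: l)
  define d where "d = gcd (x - w) (gcd (y - w) (z - w))"
  have "0 < d" using less by (simp add: d_def)
  have "d dvd x - w" "d dvd y - w" "d dvd z - w" unfolding d_def by (meson gcd_dvd1 gcd_dvd2 dvd_trans)+
  then obtain a b c where abc: "x - w = d * a" "y - w = d * b" "z - w = d * c" by (metis dvdE)
  have "d = d * gcd a (gcd b c)"
    using \<open>0 < d\<close> by (subst d_def) (simp add: abc flip: gcd_mult_distrib_int)
  then have "gcd a (gcd b c) = 1" using \<open>0 < d\<close> by simp
  moreover have "0 < a" "a < b" "b < c"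
  proof -
    have "d * 0 < d * a" "d * a < d * b" "d * b < d * c" using less abc by simp_all
    then show "0 < a" "a < b" "b < c" using \<open>0 < d\<close> by (auto simp only: mult_less_cancel_left_pos)
  qed
  ultimately have "colorable3 {0, a, b, c}" by (intro colorable3_normalized)
  from colorable3_translate[OF colorable3_scale[OF this \<open>0 < d\<close>], of w]
  have "colorable3 {w, w + d * a, w + d * b, w + d * c}" by simp
  then show ?thesis unfolding S abc[symmetric] by simp
qed

text \<open>A single translate must show all \<open>k\<close> colours. This bounds the set whose
  \<open>GREATEST\<close> defines \<open>poly_number\<close>.\<close>

lemma polychromatic_le_card:
  assumes "polychromatic k S c" "finite S"
  shows "k \<le> card S"
proof -
  have "{..<k} \<subseteq> c ` translate 0 S"
    using assms(1) unfolding polychromatic_def by (metis image_eqI lessThan_iff subsetI)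
  then have "card {..<k} \<le> card (c ` translate 0 S)"
    using assms(2) by (intro card_mono) (simp_all add: translate_def)
  also have "\<dots> \<le> card (translate 0 S)"
    using assms(2) by (intro card_image_le) (simp add: translate_def)
  also have "\<dots> \<le> card S" unfolding translate_def using assms(2) by (rule card_image_le)
  finally show ?thesis by simp
qed

theorem theorem1:
  fixes S :: "int set"
  assumes "card S = 4"
  shows "poly_number S \<ge> 3"
  unfolding poly_number_def
proof (rule Greatest_le_nat)
  show "\<exists>c. polychromatic 3 S c" using colorable3_card_4[OF assms] by (simp add: colorable3_def)
  have "finite S" using assms by (metis card.infinite zero_neq_numeral)
  then show "k \<le> 4" if "\<exists>c. polychromatic k S c" for k
    using that polychromatic_le_card assms by metis
qed

end
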